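(* Choose any $\beta,\gamma\in(0,1]$. There is a distribution of $(\beta,\gamma)$-convex $2$-clusterings $\mathcal C$ (for either notion of $(\beta,\gamma)$-convexity, the uniform-radius one or the generalized one), where $X\subseteq\mathbb R^2$ with $n=|X|$ arbitrarily large and $d$ is the Euclidean distance, such that any algorithm (even randomized) needs $\Omega(n)$ same-cluster queries to recover $\mathcal C$ with constant probability if no seed nodes are given. This holds even if $\gamma$, $\beta$ and $\epsilon$ are known.
   Context: $X$ is the finite set of points being clustered. The algorithm knows $(X,d)$ and accesses the unknown clustering only through same-cluster queries: such a query takes $x,y\in X$ and returns $1$ if they are in the same cluster of $\mathcal C$ and $0$ otherwise. A seed node for cluster $C_i$ is a point $s_i\in C_i$ given to the algorithm in advance; here none are given. For $\epsilon>0$, $G_X(\epsilon)$ is the unweighted undirected graph on $X$ in which distinct $x,y$ are adjacent iff $d(x,y)\le\epsilon$. For a graph $G$, $d_G$ is the shortest-path distance (number of edges; $\infty$ if there is no path). The length of a path is its number of edges. A $k$-clustering of $X$ is a partition $(C_1,\ldots,C_k)$ of $X$. Uniform-radius $(\beta,\gamma)$-convexity (for $\beta,\gamma\in(0,1]$): there is $\epsilon>0$ such that for each $i$: (1) the subgraph of $G_X(\epsilon)$ induced by $C_i$ is connected; (2) $d(x,y)>\beta\epsilon$ for all $x\in C_i$, $y\in X\setminus C_i$; (3) if $x,y\in C_i$, every simple path in $G_X(\epsilon)$ between $x$ and $y$ of length at most $(1+\gamma)d_{G_X(\epsilon)}(x,y)$ lies entirely in $C_i$. The smallest such $\epsilon$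 is called the radius of the clusters. Generalized $(\beta,\gamma)$-convexity (for $\beta,\gamma\in(0,1]$): for each $i$ there is $\epsilon_i>0$ (the radius of $C_i$) such that: (1) the subgraph of $G_X(\epsilon_i)$ induced by $C_i$ is connected; (2) $d(x,y)>\beta\epsilon_i$ for all $x\in C_i$, $y\in X\setminus C_i$; (3) for every $\epsilon\le\epsilon_i$, if $x,y\in C_i$ and $d_{G_X(\epsilon)}(x,y)<\infty$, every simple path in $G_X(\epsilon)$ between $x$ and $y$ of length at most $(1+\gamma)d_{G_X(\epsilon)}(x,y)$ lies entirely in $C_i$. In the claim, $\epsilon$ denotes the radius in the definition of $(\beta,\gamma)$-convexity (in the generalized notion, the radii of the clusters).
   Formalization: The claim is proved for β in (0,1) and γ in (0,1]; β = 1 is excluded because then X alone determines the convex 2-clustering (for either notion), so an algorithm knowing (X,d) needs no queries and the claim fails. *)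

theory Defs
  imports
    "HOL-Probability.Probability"
    "HOL-Library.Landau_Symbols"
    "Graph_Theory.Graph_Theory"
begin

section \<open>Neighbourhood graphs\<close>

text \<open>
  An undirected graph is represented, as in \<^theory>\<open>Graph_Theory.Digraph\<close>, by a symmetric
  digraph, so each edge contributes two opposite arcs. A simple path is an \<^const>\<open>pre_digraph.apath\<close>.
\<close>

definition nbr_graph :: "'a::metric_space set \<Rightarrow> real \<Rightarrow> ('a, 'a \<times> 'a) pre_digraph" where
  "nbr_graph X \<epsilon> =
    \<lparr>verts = X, arcs = {(x, y). x \<in> X \<and> y \<in> X \<and> x \<noteq> y \<and> dist x y \<le> \<epsilon>}, tail = fst, head = snd\<rparr>"

lemma wf_digraph_nbr_graph: "wf_digraph (nbr_graph X \<epsilon>)"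
  by unfold_locales (auto simp: nbr_graph_def)

definition hop_dist :: "'a::metric_space set \<Rightarrow> real \<Rightarrow> 'a \<Rightarrow> 'a \<Rightarrow> ereal" where
  "hop_dist X \<epsilon> x y = wf_digraph.\<mu> (nbr_graph X \<epsilon>) (\<lambda>_. 1) x y"

definition short_paths_within ::
    "real \<Rightarrow> 'a::metric_space set \<Rightarrow> real \<Rightarrow> 'a set \<Rightarrow> 'a \<Rightarrow> 'a \<Rightarrow> bool" where
  "short_paths_within \<gamma> X \<epsilon> K x y \<longleftrightarrow>
    (\<forall>p. pre_digraph.apath (nbr_graph X \<epsilon>) x p y \<and>
         ereal (real (length p)) \<le> ereal (1 + \<gamma>) * hop_dist X \<epsilon> x y \<longrightarrow>
         set (pre_digraph.awalk_verts (nbr_graph X \<epsilon>) x p) \<subseteq> K)"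


section \<open>Convex clusterings\<close>

definition clustering :: "nat \<Rightarrow> 'a set \<Rightarrow> 'a set list \<Rightarrow> bool" where
  "clustering k X C \<longleftrightarrow> length C = k \<and> distinct C \<and> partition_on X (set C)"

definition connected_with_margin :: "real \<Rightarrow> 'a::metric_space set \<Rightarrow> real \<Rightarrow> 'a set \<Rightarrow> bool" where
  "connected_with_margin \<beta> X \<epsilon> K \<longleftrightarrow>
    Digraph_Component.connected (nbr_graph X \<epsilon> \<restriction> K) \<and> (\<forall>x\<in>K. \<forall>y\<in>X - K. dist x y > \<beta> * \<epsilon>)"

definition uniform_convex ::
    "real \<Rightarrow> real \<Rightarrow> 'a::metric_space set \<Rightarrow> 'a set list \<Rightarrow> real \<Rightarrow> bool" where
  "uniform_convex \<beta> \<gamma> X C \<epsilon> \<longleftrightarrow> \<epsilon> > 0 \<and>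
    (\<forall>K\<in>set C. connected_with_margin \<beta> X \<epsilon> K \<and>
      (\<forall>x\<in>K. \<forall>y\<in>K. short_paths_within \<gamma> X \<epsilon> K x y))"

text \<open>
  The two notions of convexity are stated as relations between a clustering and the radii
  \<open>r 0, r 1, \<dots>\<close> of its clusters \<open>C ! 0, C ! 1, \<dots>\<close>; a clustering is convex if such radii exist.
  In the uniform case the common radius is the least feasible one, in the generalized case any
  feasible radii qualify.
\<close>

definition uniform_radii ::
    "real \<Rightarrow> real \<Rightarrow> 'a::metric_space set \<Rightarrow> 'a set list \<Rightarrow> (nat \<Rightarrow> real) \<Rightarrow> bool" where
  "uniform_radii \<beta> \<gamma> X C r \<longleftrightarrow>
    (\<exists>\<epsilon>. uniform_convex \<beta> \<gamma> X C \<epsilon> \<and> (\<forall>\<epsilon>'. uniform_convex \<beta> \<gamma> X C \<epsilon>' \<longrightarrow> \<epsilon> \<le> \<epsilon>') \<and>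
      (\<forall>i<length C. r i = \<epsilon>))"

definition generalized_radii ::
    "real \<Rightarrow> real \<Rightarrow> 'a::metric_space set \<Rightarrow> 'a set list \<Rightarrow> (nat \<Rightarrow> real) \<Rightarrow> bool" where
  "generalized_radii \<beta> \<gamma> X C r \<longleftrightarrow>
    (\<forall>i<length C. r i > 0 \<and> connected_with_margin \<beta> X (r i) (C ! i) \<and>
      (\<forall>\<epsilon>. 0 < \<epsilon> \<and> \<epsilon> \<le> r i \<longrightarrow>
        (\<forall>x\<in>C ! i. \<forall>y\<in>C ! i. hop_dist X \<epsilon> x y < \<infinity> \<longrightarrow> short_paths_within \<gamma> X \<epsilon> (C ! i) x y)))"


text \<open>
  For \<open>\<beta> = 1\<close> the clusters of a convex \<open>2\<close>-clustering are the connected components of a neighbourhood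
  graph, and \<open>X\<close> alone determines the clustering, whatever the radii: no query is needed.
  Lower bounds on the number of queries therefore require \<open>\<beta> < 1\<close>.
\<close>

lemma connected_subset_of_separated:
  assumes "connected_with_margin \<beta> X \<epsilon> K" "K \<subseteq> X" "\<epsilon> \<le> \<delta>"
    and "connected_with_margin 1 X \<delta> L" "x \<in> K" "x \<in> L"
  shows "K \<subseteq> L"
proof
  fix y assume "y \<in> K"
  let ?G = "with_proj (mk_symmetric (nbr_graph X \<epsilon> \<restriction> K))"
  have "x \<rightarrow>\<^sup>*\<^bsub>?G\<^esub> y"
    using assms \<open>y \<in> K\<close>
    by (auto simp: connected_with_margin_def Digraph_Component.connected_def strongly_connected_def
        mk_symmetric_def)
  then have "(x, y) \<in> rtrancl_on (verts ?G) (arcs_ends ?G)"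
    by (simp add: reachable_def)
  then show "y \<in> L"
  proof (induction rule: rtrancl_on_induct)
    case base
    then show ?case using assms by simp
  next
    case (step y z)
    then have "dist y z \<le> \<epsilon>" "z \<in> K"
      by (auto simp: mk_symmetric_def arcs_ends_def arc_to_ends_def nbr_graph_def
          induce_subgraph_def dist_commute)
    then show ?case
      using step.IH assms(2,3,4) by (force simp: connected_with_margin_def)
  qed
qed

lemma margin_one_unique:
  assumes C: "clustering 2 X C" "\<forall>K\<in>set C. connected_with_margin 1 X (r K) K"
    and C': "clustering 2 X C'" "\<forall>K\<in>set C'. connected_with_margin 1 X (r' K) K"
  shows "set C = set C'"
proof -
  have *: "set C = set C'"
    if C: "clustering 2 X C" "\<forall>K\<in>set C. connected_with_margin 1 X (r K) K"
    and C': "clustering 2 X C'" "\<forall>K\<in>set C'. connected_with_margin 1 X (r' K) K"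
    and L: "L \<in> set C'" "\<forall>K\<in>set C. r K \<le> r' L" for C C' r r' L
  proof -
    obtain K1 K2 where K: "set C = {K1, K2}" "K1 \<noteq> K2"
      using C(1) by (auto simp: clustering_def length_Suc_conv numeral_2_eq_2)
    have "card (set C' - {L}) = 1"
      using C'(1) L(1) by (simp add: clustering_def distinct_card)
    then obtain M where "set C' - {L} = {M}"
      by (auto simp: card_1_singleton_iff)
    then have M: "set C' = {L, M}" "L \<noteq> M"
      using L(1) by auto
    have P: "partition_on X {K1, K2}" "partition_on X {L, M}"
      using C(1) C'(1) K M by (simp_all add: clustering_def)
    then have eq: "K1 \<union> K2 = X" "L \<union> M = X" "K1 \<inter> K2 = {}" "L \<inter> M = {}"
      "K1 \<noteq> {}" "K2 \<noteq> {}" "L \<noteq> {}" "M \<noteq> {}"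
      using K(2) M(2) by (auto simp: partition_on_def disjoint_def)
    have sub: "K \<subseteq> L" if "K \<in> set C" "x \<in> K" "x \<in> L" for K x
    proof (rule connected_subset_of_separated)
      show "connected_with_margin 1 X (r K) K" using C(2) that(1) by simp
      show "K \<subseteq> X" using that(1) K(1) eq(1) by auto
      show "r K \<le> r' L" using L(2) that(1) by simp
      show "connected_with_margin 1 X (r' L) L" using C'(2) L(1) by simp
    qed fact+
    have "K1 \<subseteq> L \<or> K1 \<inter> L = {}" "K2 \<subseteq> L \<or> K2 \<inter> L = {}"
      using sub K(1) by auto
    then have "K1 = L \<and> K2 = M \<or> K1 = M \<and> K2 = L"
    proof (elim disjE)
      assume "K1 \<subseteq> L" "K2 \<subseteq> L"
      then have "M \<subseteq> L" using eq(1,2) by blast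
      then show ?thesis using eq(4,8) by blast
    next
      assume "K1 \<inter> L = {}" "K2 \<inter> L = {}"
      then have "L = {}" using eq(1,2) by blast
      then show ?thesis using eq(7) by blast
    next
      assume "K1 \<subseteq> L" "K2 \<inter> L = {}"
      then have "K1 = L" "K2 = M" using eq(1-4) by blast+
      then show ?thesis by blast
    next
      assume "K1 \<inter> L = {}" "K2 \<subseteq> L"
      then have "K2 = L" "K1 = M" using eq(1-4) by blast+
      then show ?thesis by blast
    qed
    then show ?thesis using K M by auto
  qed
  have max: "\<exists>K\<in>set B. \<forall>M\<in>set B. s M \<le> s K"
    if "clustering 2 X B" for B and s :: "'a set \<Rightarrow> real"
  proof -
    have "set B \<noteq> {}"
      using that by (auto simp: clustering_def)
    then obtain K where "K \<in> set B" "Max (s ` set B) = s K"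
      by (meson List.finite_set obtains_MAX)
    then show ?thesis
      by (intro bexI[of _ K]) (auto simp flip: \<open>Max (s ` set B) = s K\<close>)
  qed
  obtain K L where KL: "K \<in> set C" "\<forall>M\<in>set C. r M \<le> r K"
      "L \<in> set C'" "\<forall>M\<in>set C'. r' M \<le> r' L"
    using max[OF C(1)] max[OF C'(1)] by blast
  show ?thesis
  proof (cases "r K \<le> r' L")
    case True
    with KL have "\<forall>M\<in>set C. r M \<le> r' L" by force
    then show ?thesis using *[OF C C'] KL by blast
  next
    case False
    with KL have "\<forall>M\<in>set C'. r' M \<le> r K" by force
    then show ?thesis using *[OF C' C] KL by blast
  qed
qed

lemma convex_margin_one_unique:
  assumes "clustering 2 X C" "uniform_radii 1 \<gamma> X C r \<or> generalized_radii 1 \<gamma> X C r"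
    and "clustering 2 X C'" "uniform_radii 1 \<gamma> X C' r' \<or> generalized_radii 1 \<gamma> X C' r'"
  shows "set C = set C'"
proof -
  have "\<exists>\<rho>. \<forall>K\<in>set C. connected_with_margin 1 X (\<rho> K) K"
    if "clustering 2 X C" "uniform_radii 1 \<gamma> X C r \<or> generalized_radii 1 \<gamma> X C r" for C r
    using that(2)
  proof
    assume "uniform_radii 1 \<gamma> X C r"
    then show ?thesis by (auto simp: uniform_radii_def uniform_convex_def)
  next
    assume "generalized_radii 1 \<gamma> X C r"
    then have "\<forall>K\<in>set C. \<exists>\<epsilon>. connected_with_margin 1 X \<epsilon> K"
      unfolding generalized_radii_def all_set_conv_all_nth by blast
    then show ?thesis by metis
  qed
  then show ?thesis
    using assms margin_one_unique[OF assms(1) _ assms(3)] by blast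
qed


section \<open>Query algorithms\<close>

text \<open>
  A deterministic algorithm on a fixed instance is a decision tree over yes/no queries; a
  randomized algorithm is a probability distribution over such trees.
\<close>

datatype (asked: 'q, 'o) query_tree =
  Output 'o
| Ask 'q "bool \<Rightarrow> ('q, 'o) query_tree"

primrec run :: "('q \<Rightarrow> bool) \<Rightarrow> ('q, 'o) query_tree \<Rightarrow> 'o" where
  "run oracle (Output z) = z"
| "run oracle (Ask q next) = run oracle (next (oracle q))"

primrec num_queries :: "('q \<Rightarrow> bool) \<Rightarrow> ('q, 'o) query_tree \<Rightarrow> nat" where
  "num_queries oracle (Output z) = 0"
| "num_queries oracle (Ask q next) = Suc (num_queries oracle (next (oracle q)))"

definition same_cluster :: "'a set list \<Rightarrow> 'a \<times> 'a \<Rightarrow> bool" where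
  "same_cluster C = (\<lambda>(x, y). \<exists>K\<in>set C. x \<in> K \<and> y \<in> K)"

type_synonym 'a cluster_algorithm = "('a \<times> 'a, 'a set set) query_tree pmf"

text \<open>
  The labels of the clusters are invisible to the queries, so recovering a clustering means
  outputting it as an unordered partition.
\<close>

definition recovery_prob :: "'a set list pmf \<Rightarrow> 'a cluster_algorithm \<Rightarrow> real" where
  "recovery_prob D A =
    measure_pmf.prob (pair_pmf D A) {(C, T). run (same_cluster C) T = set C}"

definition query_bound ::
    "'a set \<Rightarrow> 'a set list pmf \<Rightarrow> 'a cluster_algorithm \<Rightarrow> nat \<Rightarrow> bool" where
  "query_bound X D A q \<longleftrightarrow>
    (\<forall>T\<in>set_pmf A. asked T \<subseteq> X \<times> X \<and> (\<forall>C\<in>set_pmf D. num_queries (same_cluster C) T \<le> q))"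

end

theory Submission
  imports Defs
begin

text \<open>
  The points form a comb: a spine of unit steps with a leaf at distance \<open>1\<close> from each spine point. At
  every scale \<open>\<epsilon> \<le> 1\<close> a leaf has at most one neighbour, so no simple path passes through it, and
  splitting off any single leaf is a convex clustering of radius \<open>1\<close> in both senses. If the leaf is
  chosen uniformly at random, a query \<open>(x, y)\<close> has a predictable answer unless \<open>x\<close> or \<open>y\<close> is the
  chosen leaf, so \<open>q\<close> queries identify at most \<open>2 q + 1\<close> of the leaves.
\<close>

section \<open>Neighbourhood graphs\<close>

lemma nbr_graph_simps [simp]:
  "verts (nbr_graph X \<epsilon>) = X"
  "(x, y) \<in> arcs (nbr_graph X \<epsilon>) \<longleftrightarrow> x \<in> X \<and> y \<in> X \<and> x \<noteq> y \<and> dist x y \<le> \<epsilon>"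
  "tail (nbr_graph X \<epsilon>) = fst"
  "head (nbr_graph X \<epsilon>) = snd"
  by (simp_all add: nbr_graph_def)

text \<open>The library defines connectedness as strong connectedness of the symmetrised graph.
  Since \<open>dist\<close> is symmetric, walks can be reversed, so two points of \<open>K\<close>
  are joined through the root \<open>z\<close>.\<close>

lemma connected_nbr_graphI:
  assumes "K \<subseteq> X" "z \<in> K"
    and "\<And>y. y \<in> K \<Longrightarrow> (z, y) \<in> {(u, v). u \<in> K \<and> v \<in> K \<and> u \<noteq> v \<and> dist u v \<le> \<epsilon>}\<^sup>*"
  shows "Digraph_Component.connected (nbr_graph X \<epsilon> \<restriction> K)"
proof -
  let ?R = "{(u, v). u \<in> K \<and> v \<in> K \<and> u \<noteq> v \<and> dist u v \<le> \<epsilon>}"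
  let ?G = "with_proj (mk_symmetric (nbr_graph X \<epsilon> \<restriction> K))"
  have verts: "verts ?G = K"
    by (simp add: mk_symmetric_def induce_subgraph_def)
  have ends: "?R \<subseteq> arcs_ends ?G"
    using assms(1)
    by (force simp: mk_symmetric_def arcs_ends_def arc_to_ends_def induce_subgraph_def)
  have "sym (?R\<^sup>*)"
    by (intro sym_rtrancl) (auto simp: sym_def dist_commute)
  then have R: "(u, v) \<in> ?R\<^sup>*" if "u \<in> K" "v \<in> K" for u v
    using assms(3)[OF that(1)] assms(3)[OF that(2)] by (meson rtrancl_trans symE)
  have "(u, v) \<in> rtrancl_on K (arcs_ends ?G)" if "(u, v) \<in> ?R\<^sup>*" "u \<in> K" for u v
    using that
  proof (induction rule: rtrancl_induct)
    case base
    then show ?case by simp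
  next
    case (step v w)
    then have "(v, w) \<in> arcs_ends ?G" "w \<in> K"
      using ends by auto
    then show ?case
      using step by (meson rtrancl_on_into_rtrancl_on)
  qed
  then have "u \<rightarrow>\<^sup>*\<^bsub>?G\<^esub> v" if "u \<in> K" "v \<in> K" for u v
    using R that by (simp add: reachable_def verts)
  then show ?thesis
    using assms(2) verts
    by (auto simp: Digraph_Component.connected_def strongly_connected_def)
qed

text \<open>Below scale \<delta> the induced graph has no arcs, so a point reaches only itself. This
  supplies the minimality of the radius in the uniform notion.\<close>

lemma connected_nbr_graph_radius_ge:
  assumes "Digraph_Component.connected (nbr_graph X \<epsilon> \<restriction> K)" "K \<subseteq> X" "a \<in> K" "b \<in> K" "a \<noteq> b"
    and sep: "\<And>u v. u \<in> K \<Longrightarrow> v \<in> K \<Longrightarrow> u \<noteq> v \<Longrightarrow> \<delta> \<le> dist u v"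
  shows "\<delta> \<le> \<epsilon>"
proof (rule ccontr)
  assume "\<not> \<delta> \<le> \<epsilon>"
  let ?G = "with_proj (mk_symmetric (nbr_graph X \<epsilon> \<restriction> K))"
  have "a \<rightarrow>\<^sup>*\<^bsub>?G\<^esub> b"
    using assms by (auto simp: Digraph_Component.connected_def strongly_connected_def mk_symmetric_def)
  then have "(a, b) \<in> rtrancl_on (verts ?G) (arcs_ends ?G)"
    by (simp add: reachable_def)
  then have "b = a"
  proof (induction rule: rtrancl_on_induct)
    case (step y z)
    then have "dist y z \<le> \<epsilon>" "z \<in> K" "y \<in> K" "y \<noteq> z"
      by (auto simp: mk_symmetric_def arcs_ends_def arc_to_ends_def nbr_graph_def
          induce_subgraph_def dist_commute)
    then show ?case
      using sep[of y z] \<open>\<not> \<delta> \<le> \<epsilon>\<close> by simp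
  qed simp
  then show False using assms(5) by simp
qed

section \<open>Simple paths and leaves\<close>

text \<open>A path with \<open>v\<close> in its interior enters \<open>v\<close> from its only
  neighbour \<open>w\<close> and has to leave to \<open>w\<close> again, which a simple path cannot
  do.\<close>

lemma apath_avoids_leaf:
  assumes "pre_digraph.apath (nbr_graph X \<epsilon>) x p y"
    and "v \<noteq> x" "v \<noteq> y"
    and "\<And>u. u \<in> X \<Longrightarrow> u \<noteq> v \<Longrightarrow> dist u v \<le> \<epsilon> \<Longrightarrow> u = w"
  shows "v \<notin> set (pre_digraph.awalk_verts (nbr_graph X \<epsilon>) x p)"
  using assms(1-3)
proof (induction p arbitrary: x)
  case Nil
  then show ?case
    by (simp add: pre_digraph.awalk_verts.simps)
next
  case (Cons e p)
  interpret wf_digraph "nbr_graph X \<epsilon>"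
    by (rule wf_digraph_nbr_graph)
  have e: "fst e = x" "x \<in> X" "snd e \<in> X" "x \<noteq> snd e" "dist x (snd e) \<le> \<epsilon>"
    and p: "apath (snd e) p y" "x \<notin> set (awalk_verts (snd e) p)"
    using Cons.prems(1) by (cases e; auto simp: apath_Cons_iff)+
  \<comment> \<open>The induction peels off the first arc, so \<open>snd e\<close> becomes the new
    start and must again differ from \<open>v\<close>.\<close>
  have "v \<noteq> snd e"
  proof
    assume v: "v = snd e"
    then have "x = w"
      using assms(4) e by auto
    \<comment> \<open>The path cannot stop at \<open>v\<close>, because it ends in \<open>y\<close>;
      \<open>e'\<close> is the arc by which it leaves \<open>v\<close>.\<close>
    obtain e' p' where p': "p = e' # p'"
      using p(1) v Cons.prems(3) by (cases p) (auto simp: apath_Nil_iff)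
    then have "fst e' = v" "snd e' \<in> X" "v \<noteq> snd e'" "dist v (snd e') \<le> \<epsilon>"
      using p(1) v by (cases e'; auto simp: apath_Cons_iff)+
    then have "snd e' = w"
      using assms(4)[of "snd e'"] by (simp add: dist_commute)
    moreover have "snd e' \<in> set (awalk_verts (snd e) p)"
      using p(1) unfolding p' by (cases p') (auto simp: apath_Cons_iff)
    ultimately show False
      using p(2) \<open>x = w\<close> by simp
  qed
  then have "v \<notin> set (awalk_verts (snd e) p)"
    using Cons.IH p(1) Cons.prems(3) by blast
  then show ?case
    using Cons.prems(2) e(1) by simp
qed

text \<open>A simple path from \<open>v\<close> to \<open>v\<close> is empty: after a first arc the
  remaining walk would end in \<open>v\<close> and so visit it twice.\<close>

lemma short_paths_within_singleton: "short_paths_within \<gamma> X \<epsilon> {v} v v"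
  unfolding short_paths_within_def
proof (intro allI impI)
  interpret wf_digraph "nbr_graph X \<epsilon>"
    by (rule wf_digraph_nbr_graph)
  fix p
  assume "apath v p v \<and> ereal (real (length p)) \<le> ereal (1 + \<gamma>) * hop_dist X \<epsilon> v v"
  then have p: "apath v p v" by simp
  have "p = []"
  proof (cases p)
    case (Cons e es)
    then have "cas (head (nbr_graph X \<epsilon>) e) es v"
      and "v \<notin> set (awalk_verts (head (nbr_graph X \<epsilon>) e) es)"
      using p by (auto simp: apath_Cons_iff apath_def awalk_def)
    then show ?thesis
      using awlast_if_cas last_in_set awalk_verts_non_Nil by metis
  qed
  then show "set (awalk_verts v p) \<subseteq> {v}"
    by simp
qed

lemma short_paths_within_remove_leaf:
  assumes "\<And>u. u \<in> X \<Longrightarrow> u \<noteq> v \<Longrightarrow> dist u v \<le> \<epsilon> \<Longrightarrow> u = w"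
    and "x \<in> X - {v}" "y \<in> X - {v}"
  shows "short_paths_within \<gamma> X \<epsilon> (X - {v}) x y"
  unfolding short_paths_within_def
proof (intro allI impI)
  interpret wf_digraph "nbr_graph X \<epsilon>"
    by (rule wf_digraph_nbr_graph)
  fix p
  assume "apath x p y \<and> ereal (real (length p)) \<le> ereal (1 + \<gamma>) * hop_dist X \<epsilon> x y"
  then have p: "apath x p y" by simp
  then have "set (awalk_verts x p) \<subseteq> X"
    using awalk_verts_in_verts[of x p] by (auto simp: apath_def awalk_def)
  moreover have "v \<notin> set (awalk_verts x p)"
    using apath_avoids_leaf[OF p, of v w] assms by auto
  ultimately show "set (awalk_verts x p) \<subseteq> X - {v}"
    by blast
qed

section \<open>Convexity of the split at a leaf\<close>

text \<open>Radius 1 satisfies the margin condition because distances are at least 1 and \<beta> <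
  1. The points \<open>a\<close> and \<open>b\<close> witness that the big cluster is not a
  singleton, so no smaller radius can connect it.\<close>

lemma leaf_split_has_radii:
  assumes has: "has_radii = uniform_radii \<or> has_radii = generalized_radii"
    and v: "v \<in> X" and ab: "a \<in> X - {v}" "b \<in> X - {v}" "a \<noteq> b" and \<beta>: "\<beta> < 1"
    and sep: "\<And>x y. x \<in> X \<Longrightarrow> y \<in> X \<Longrightarrow> x \<noteq> y \<Longrightarrow> 1 \<le> dist x y"
    and leaf: "\<And>u. u \<in> X \<Longrightarrow> u \<noteq> v \<Longrightarrow> dist u v \<le> 1 \<Longrightarrow> u = w"
    and conn: "Digraph_Component.connected (nbr_graph X 1 \<restriction> (X - {v}))"
  shows "has_radii \<beta> \<gamma> X [{v}, X - {v}] (\<lambda>_. 1)"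
proof -
  let ?C = "[{v}, X - {v}]"
  have margin: "\<beta> < dist x y" if "x \<in> X" "y \<in> X" "x \<noteq> y" for x y
    using sep[OF that] \<beta> by linarith
  have "Digraph_Component.connected (nbr_graph X 1 \<restriction> {v})"
    using v by (intro connected_nbr_graphI[of _ _ v]) auto
  then have margin_conn: "connected_with_margin \<beta> X 1 K" if "K \<in> set ?C" for K
    using that v conn margin by (auto simp: connected_with_margin_def)
  have short: "short_paths_within \<gamma> X \<epsilon> K x y" if "K \<in> set ?C" "x \<in> K" "y \<in> K" "\<epsilon> \<le> 1" for K x y \<epsilon>
  proof -
    \<comment> \<open>A leaf at scale 1 keeps at most the neighbour \<open>w\<close> at smaller
      scales, which covers every \<epsilon> quantified over in the generalized notion.\<close>
    have "u = w" if "u \<in> X" "u \<noteq> v" "dist u v \<le> \<epsilon>" for u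
      using leaf that \<open>\<epsilon> \<le> 1\<close> by auto
    then show ?thesis
      using that short_paths_within_singleton short_paths_within_remove_leaf[of X v \<epsilon> w] by auto
  qed
  have "uniform_radii \<beta> \<gamma> X ?C (\<lambda>_. 1)"
    unfolding uniform_radii_def
  proof (intro exI[of _ 1] conjI allI impI)
    show "uniform_convex \<beta> \<gamma> X ?C 1"
      unfolding uniform_convex_def using margin_conn short[OF _ _ _ order_refl]
      by (intro conjI ballI) simp_all
  next
    fix \<epsilon>
    assume "uniform_convex \<beta> \<gamma> X ?C \<epsilon>"
    then have "Digraph_Component.connected (nbr_graph X \<epsilon> \<restriction> (X - {v}))"
      by (simp add: uniform_convex_def connected_with_margin_def)
    then show "1 \<le> \<epsilon>"
      by (rule connected_nbr_graph_radius_ge[of _ _ _ a b]) (use ab sep in auto)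
  qed simp
  moreover have "generalized_radii \<beta> \<gamma> X ?C (\<lambda>_. 1)"
    unfolding generalized_radii_def
  proof (intro allI impI conjI ballI)
    fix i assume "i < length ?C"
    then have "?C ! i \<in> set ?C" by (rule nth_mem)
    then show "connected_with_margin \<beta> X 1 (?C ! i)"
      by (rule margin_conn)
    fix \<epsilon> :: real and x y
    assume "0 < \<epsilon> \<and> \<epsilon> \<le> 1" "x \<in> ?C ! i" "y \<in> ?C ! i"
    then show "short_paths_within \<gamma> X \<epsilon> (?C ! i) x y"
      using short[OF \<open>?C ! i \<in> set ?C\<close>] by blast
  qed simp
  ultimately show ?thesis
    using has by auto
qed

section \<open>The comb\<close>

text \<open>
  Even indices enumerate the spine; the leaf \<open>2 * i + 1\<close> hangs off the spine point \<open>2 * i\<close>. The leaves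
  alternate between the two sides of the spine so that they stay further than \<open>1\<close> apart.
\<close>

definition comb_height :: "nat \<Rightarrow> int" where
  "comb_height k = (if k mod 4 = 1 then 1 else if k mod 4 = 3 then - 1 else 0)"

definition comb_point :: "nat \<Rightarrow> real ^ 2" where
  "comb_point k = vector [real (k div 2), real_of_int (comb_height k)]"

lemma comb_height_eq_0_iff: "comb_height k = 0 \<longleftrightarrow> even k"
proof -
  have "k mod 4 = 1 \<or> k mod 4 = 3 \<longleftrightarrow> odd k" by presburger
  then show ?thesis by (auto simp: comb_height_def)
qed

text \<open>With the squared distance exhibited as an integer, comparisons with 1 reduce to integer
  arithmetic.\<close>

lemma dist_comb_point:
  "dist (comb_point k) (comb_point l) =
    sqrt (real_of_int ((int (k div 2) - int (l div 2))\<^sup>2 + (comb_height k - comb_height l)\<^sup>2))"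
  by (simp add: comb_point_def dist_vec_def L2_set_def sum_2 dist_real_def)

lemma int_sum_squares_le_1:
  fixes a b :: int
  assumes "a\<^sup>2 + b\<^sup>2 \<le> 1"
  shows "a = 0 \<and> \<bar>b\<bar> \<le> 1 \<or> b = 0 \<and> \<bar>a\<bar> \<le> 1"
proof -
  have sq: "c\<^sup>2 \<ge> 1" if "c \<noteq> 0" for c :: int
    using that by (simp add: int_one_le_iff_zero_less)
  have "a\<^sup>2 \<le> 1" "b\<^sup>2 \<le> 1"
    using assms zero_le_power2[of a] zero_le_power2[of b] by linarith+
  then have "\<bar>a\<bar> \<le> 1" "\<bar>b\<bar> \<le> 1"
    by (simp_all add: abs_square_le_1)
  moreover have "a = 0 \<or> b = 0"
    using sq[of a] sq[of b] assms by linarith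
  ultimately show ?thesis by auto
qed

lemma comb_point_separated:
  assumes "k \<noteq> l"
  shows "1 \<le> dist (comb_point k) (comb_point l)"
proof -
  let ?a = "int (k div 2) - int (l div 2)" and ?b = "comb_height k - comb_height l"
  have "\<not> (?a = 0 \<and> ?b = 0)"
  proof
    assume "?a = 0 \<and> ?b = 0"
    then have "k div 2 = l div 2" "comb_height k = comb_height l" by auto
    \<comment> \<open>The height is zero exactly on the spine, so it reveals the parity of the
      index; parity and \<open>k div 2\<close> together determine \<open>k\<close>.\<close>
    then have "even k \<longleftrightarrow> even l"
      by (metis comb_height_eq_0_iff)
    then show False
      using \<open>k div 2 = l div 2\<close> assms by presburger
  qed
  then have "1 \<le> ?a\<^sup>2 + ?b\<^sup>2"
    using sum_power2_gt_zero_iff[of ?a ?b] by linarith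
  then have "1 \<le> real_of_int (?a\<^sup>2 + ?b\<^sup>2)"
    by linarith
  then show ?thesis
    unfolding dist_comb_point by (rule real_sqrt_ge_one)
qed

lemma comb_point_eq_iff [simp]: "comb_point k = comb_point l \<longleftrightarrow> k = l"
  using comb_point_separated[of k l] by (cases "k = l") auto

text \<open>Lattice points within distance 1 agree in one coordinate. In the same column only the
  spine point is left; at the same height the candidates are leaves of adjacent columns, which lie
  on the opposite side of the spine.\<close>

lemma comb_leaf_neighbour:
  assumes "dist (comb_point k) (comb_point (2 * i + 1)) \<le> 1" "k \<noteq> 2 * i + 1"
  shows "k = 2 * i"
proof -
  let ?a = "int (k div 2) - int i" and ?b = "comb_height k - comb_height (2 * i + 1)"
  have "real_of_int (?a\<^sup>2 + ?b\<^sup>2) \<le> 1"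
    using assms(1) unfolding dist_comb_point by simp
  then have "?a\<^sup>2 + ?b\<^sup>2 \<le> 1"
    by linarith
  then have "?a = 0 \<and> \<bar>?b\<bar> \<le> 1 \<or> ?b = 0 \<and> \<bar>?a\<bar> \<le> 1"
    by (rule int_sum_squares_le_1)
  then show ?thesis
  proof
    assume "?a = 0 \<and> \<bar>?b\<bar> \<le> 1"
    then have "k div 2 = i" by linarith
    then show ?thesis using assms(2) by presburger
  next
    assume *: "?b = 0 \<and> \<bar>?a\<bar> \<le> 1"
    then have "comb_height k = comb_height (2 * i + 1)" by simp
    moreover have "(2 * i + 1) mod 4 = 1 \<or> (2 * i + 1) mod 4 = 3" by presburger
    ultimately have mod4: "k mod 4 = (2 * i + 1) mod 4"
      unfolding comb_height_def by (auto split: if_splits)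
    then have "odd k" by presburger
    then obtain m where m: "k = 2 * m + 1" by (rule oddE)
    \<comment> \<open>Leaves on the same side have columns of equal parity, so columns differing by
      at most 1 coincide, contradicting \<open>k \<noteq> 2 * i + 1\<close>.\<close>
    with mod4 have "even m \<longleftrightarrow> even i" by presburger
    moreover have "m = i \<or> m = i + 1 \<or> i = m + 1"
      using * m by auto
    ultimately show ?thesis
      using assms(2) m by auto
  qed
qed

lemma dist_comb_leaf_spine: "dist (comb_point (2 * i)) (comb_point (2 * i + 1)) = 1"
proof -
  have "comb_height (2 * i) = 0" "(comb_height (2 * i + 1))\<^sup>2 = 1"
    unfolding comb_height_def by (auto, presburger+)
  then show ?thesis
    unfolding dist_comb_point by simp
qed

lemma dist_comb_spine: "dist (comb_point (2 * i)) (comb_point (2 * i + 2)) = 1"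
proof -
  have "comb_height (2 * i) = 0" "comb_height (2 * i + 2) = 0"
    unfolding comb_height_def by (auto, presburger+)
  then show ?thesis
    unfolding dist_comb_point by simp
qed

text \<open>The removed index is odd, so the spine survives intact, and each remaining leaf is
  attached to its spine point, whose index is one smaller and hence also below
  \<open>n\<close>.\<close>

lemma comb_connected_without_leaf:
  assumes "2 * j + 1 < n"
  defines "X \<equiv> comb_point ` {..<n}"
  defines "K \<equiv> X - {comb_point (2 * j + 1)}"
  shows "Digraph_Component.connected (nbr_graph X 1 \<restriction> K)"
proof (rule connected_nbr_graphI[of _ _ "comb_point 0"])
  let ?R = "{(u, v). u \<in> K \<and> v \<in> K \<and> u \<noteq> v \<and> dist u v \<le> 1}"
  show "K \<subseteq> X" by (auto simp: K_def)
  have K: "comb_point k \<in> K \<longleftrightarrow> k < n \<and> k \<noteq> 2 * j + 1" for k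
    by (auto simp: K_def X_def)
  then show "comb_point 0 \<in> K" using assms by simp
  have spine: "(comb_point 0, comb_point (2 * i)) \<in> ?R\<^sup>*" if "2 * i < n" for i
    using that
  proof (induction i)
    case (Suc i)
    have "2 * i \<noteq> 2 * j + 1" "2 * i + 2 \<noteq> 2 * j + 1" by presburger+
    then have "(comb_point (2 * i), comb_point (2 * i + 2)) \<in> ?R"
      using Suc.prems dist_comb_spine[of i] by (simp add: K)
    moreover have "(comb_point 0, comb_point (2 * i)) \<in> ?R\<^sup>*"
      using Suc by simp
    ultimately show ?case
      by (simp add: rtrancl.rtrancl_into_rtrancl)
  qed simp
  fix y
  assume "y \<in> K"
  then obtain k where k: "y = comb_point k" "k < n" "k \<noteq> 2 * j + 1"
    by (auto simp: K_def X_def)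
  show "(comb_point 0, y) \<in> ?R\<^sup>*"
  proof (cases "even k")
    case True
    then show ?thesis using spine[of "k div 2"] k by simp
  next
    case False
    then obtain i where i: "k = 2 * i + 1" by (auto elim: oddE)
    have "2 * i \<noteq> 2 * j + 1" by presburger
    then have "(comb_point (2 * i), y) \<in> ?R"
      using k i dist_comb_leaf_spine[of i] by (simp add: K)
    then show ?thesis
      using spine[of i] k i by (simp add: rtrancl.rtrancl_into_rtrancl)
  qed
qed

section \<open>Query complexity\<close>

lemma clustering_split_point:
  assumes "v \<in> X" "X - {v} \<noteq> {}"
  shows "clustering 2 X [{v}, X - {v}]"
proof -
  have "distinct [{v}, X - {v}]" by auto
  then show ?thesis
    unfolding clustering_def partition_on_def
    using assms by (auto simp: disjoint_def)
qed

text \<open>The right-hand side does not mention \<open>v\<close>: this is the predictable answer,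
  which carries no information about which other point was split off.\<close>

lemma same_cluster_split_point:
  assumes "v \<noteq> x" "v \<noteq> y"
  shows "same_cluster [{v}, X - {v}] (x, y) \<longleftrightarrow> x \<in> X \<and> y \<in> X"
  using assms by (auto simp: same_cluster_def)

text \<open>In a two-point set both splits give the same unordered partition; from three points on,
  the complement of a point is not a singleton, so the singleton block identifies
  \<open>v\<close>.\<close>

lemma inj_split_point:
  assumes "3 \<le> card X"
  shows "inj_on (\<lambda>v. {{v}, X - {v}}) X"
proof (rule inj_onI)
  fix v w
  assume vw: "v \<in> X" "w \<in> X" and eq: "{{v}, X - {v}} = {{w}, X - {w}}"
  then have "{v} = {w} \<or> {v} = X - {w}" by blast
  then show "v = w"
  proof
    assume "{v} = X - {w}"
    then have "X = {v, w}" using vw by blast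
    then have "card X \<le> 2"
      by (simp add: card_insert_if)
    then show ?thesis using assms by simp
  qed simp
qed

section \<open>Counting the instances that a decision tree solves\<close>

text \<open>Follow the branch of the predictable answers. Each query on it loses at most
  \<open>c\<close> candidates, and the single output at its end fits at most one target.\<close>

lemma card_run_correct_le:
  fixes ans :: "'i \<Rightarrow> 'q \<Rightarrow> bool"
  assumes "finite S" "inj_on target S"
    and "\<And>e. \<exists>b. card {j \<in> S. ans j e \<noteq> b} \<le> c"
    and "\<And>j. j \<in> S \<Longrightarrow> num_queries (ans j) T \<le> q"
  shows "card {j \<in> S. run (ans j) T = target j} \<le> c * q + 1"
  using assms
proof (induction T arbitrary: S q)
  case (Output z)
  have "\<forall>i\<in>{j \<in> S. z = target j}. \<forall>j\<in>{j \<in> S. z = target j}. i = j"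
    using Output.prems(2) by (auto dest: inj_onD)
  then have "card {j \<in> S. z = target j} \<le> 1"
    using card_le_Suc0_iff_eq[of "{j \<in> S. z = target j}"] Output.prems(1) by simp
  then show ?case by simp
next
  case (Ask e cont)
  show ?case
  proof (cases "S = {}")
    case False
    then obtain i where "i \<in> S" by blast
    \<comment> \<open>Some candidate really asks this query, so the budget is positive and
      \<open>q'\<close> queries remain for the subtree.\<close>
    then obtain q' where q: "q = Suc q'"
      using Ask.prems(4)[of i] by (cases q) auto
    obtain b where b: "card {j \<in> S. ans j e \<noteq> b} \<le> c"
      using Ask.prems(3) by blast
    let ?S = "{j \<in> S. ans j e = b}"
    have "card {j \<in> ?S. run (ans j) (cont b) = target j} \<le> c * q' + 1"
    proof (rule Ask.IH)
      show "cont b \<in> range cont" by simp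
      show "finite ?S" using Ask.prems(1) by simp
      show "inj_on target ?S" using Ask.prems(2) by (rule inj_on_subset) auto
      fix j assume "j \<in> ?S"
      then show "num_queries (ans j) (cont b) \<le> q'"
        using Ask.prems(4)[of j] q by simp
    next
      fix e'
      obtain b' where "card {j \<in> S. ans j e' \<noteq> b'} \<le> c"
        using Ask.prems(3) by blast
      moreover have "card {j \<in> ?S. ans j e' \<noteq> b'} \<le> card {j \<in> S. ans j e' \<noteq> b'}"
        using Ask.prems(1) by (intro card_mono) auto
      ultimately show "\<exists>b'. card {j \<in> ?S. ans j e' \<noteq> b'} \<le> c"
        using le_trans by blast
    qed
    \<comment> \<open>The candidates that deviate from \<open>b\<close> are all conceded as solved;
      the others continue together in \<open>cont b\<close>.\<close>
    moreover have "card {j \<in> S. run (ans j) (Ask e cont) = target j}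
      \<le> card ({j \<in> ?S. run (ans j) (cont b) = target j} \<union> {j \<in> S. ans j e \<noteq> b})"
    proof (intro card_mono subsetI)
      fix j assume "j \<in> {j \<in> S. run (ans j) (Ask e cont) = target j}"
      then show "j \<in> {j \<in> ?S. run (ans j) (cont b) = target j} \<union> {j \<in> S. ans j e \<noteq> b}"
        by (cases "ans j e = b") simp_all
    qed (use Ask.prems(1) in simp)
    moreover have "\<dots> \<le> card {j \<in> ?S. run (ans j) (cont b) = target j}
        + card {j \<in> S. ans j e \<noteq> b}"
      by (rule card_Un_le)
    ultimately show ?thesis
      using b q by simp
  qed simp
qed

text \<open>This is the averaging direction of Yao's principle: the success probability of a
  randomized algorithm is an average over its trees, each of which solves at most \<open>B\<close>
  of the equally likely instances.\<close>

lemma recovery_prob_uniform_le: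
  assumes "finite S" "S \<noteq> {}"
    and "\<And>T. T \<in> set_pmf A \<Longrightarrow> card {j \<in> S. run (same_cluster (F j)) T = set (F j)} \<le> B"
  shows "recovery_prob (map_pmf F (pmf_of_set S)) A \<le> real B / real (card S)"
proof -
  let ?D = "map_pmf F (pmf_of_set S)"
  let ?E = "{(C, T). run (same_cluster C) T = set C}"
  \<comment> \<open>The sampling order is swapped so that the tree is fixed before the instance is
    drawn.\<close>
  have "pair_pmf ?D A = bind_pmf A (\<lambda>T. map_pmf (\<lambda>C. (C, T)) ?D)"
    unfolding pair_pmf_def map_pmf_def by (rule bind_commute_pmf)
  then have "emeasure (pair_pmf ?D A) ?E = (\<integral>\<^sup>+T. emeasure (map_pmf (\<lambda>C. (C, T)) ?D) ?E \<partial>A)"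
    by (simp only: emeasure_bind_pmf)
  also have "\<dots> \<le> (\<integral>\<^sup>+T. ennreal (real B / real (card S)) \<partial>A)"
  proof (rule nn_integral_mono_AE, simp only: AE_measure_pmf_iff, rule ballI)
    fix T assume T: "T \<in> set_pmf A"
    let ?J = "{j. run (same_cluster (F j)) T = set (F j)}"
    have "emeasure (map_pmf (\<lambda>C. (C, T)) ?D) ?E = emeasure (pmf_of_set S) ?J"
      by (simp add: vimage_def)
    also have "\<dots> = ennreal (real (card (S \<inter> ?J)) / real (card S))"
      by (simp add: measure_pmf.emeasure_eq_measure measure_pmf_of_set assms)
    also have "\<dots> \<le> ennreal (real B / real (card S))"
      using assms(3)[OF T] by (intro ennreal_leI divide_right_mono) (simp_all add: Int_def)
    finally show "emeasure (map_pmf (\<lambda>C. (C, T)) ?D) ?E \<le> ennreal (real B / real (card S))" .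
  qed
  also have "\<dots> = ennreal (real B / real (card S))"
    by simp
  finally show ?thesis
    unfolding recovery_prob_def measure_pmf.emeasure_eq_measure by (simp add: ennreal_le_iff)
qed

lemma recovery_prob_split_point_le:
  assumes X: "finite X" "3 \<le> card X" and L: "L \<subseteq> X" "L \<noteq> {}"
    and q: "query_bound X (map_pmf (\<lambda>v. [{v}, X - {v}]) (pmf_of_set L)) A q"
  shows "recovery_prob (map_pmf (\<lambda>v. [{v}, X - {v}]) (pmf_of_set L)) A
    \<le> real (2 * q + 1) / real (card L)"
proof (rule recovery_prob_uniform_le)
  show "finite L" using L X finite_subset by blast
  show "L \<noteq> {}" by fact
  fix T assume T: "T \<in> set_pmf A"
  have "card {v \<in> L. run (same_cluster [{v}, X - {v}]) T = {{v}, X - {v}}} \<le> 2 * q + 1"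
  proof (rule card_run_correct_le)
    show "inj_on (\<lambda>v. {{v}, X - {v}}) L"
      using inj_split_point[OF X(2)] L(1) by (rule inj_on_subset)
    show "num_queries (same_cluster [{v}, X - {v}]) T \<le> q" if "v \<in> L" for v
      using q T that \<open>finite L\<close> L(2) by (auto simp: query_bound_def)
    show "\<exists>b. card {v \<in> L. same_cluster [{v}, X - {v}] e \<noteq> b} \<le> 2" for e
    proof -
      obtain x y where e: "e = (x, y)" by force
      \<comment> \<open>Only the two queried points can spoil the predictable answer, whence
        \<open>c = 2\<close>.\<close>
      have "{v \<in> L. same_cluster [{v}, X - {v}] e \<noteq> (x \<in> X \<and> y \<in> X)} \<subseteq> {x, y}"
        using same_cluster_split_point[of _ x y X] e by blast
      then have "card {v \<in> L. same_cluster [{v}, X - {v}] e \<noteq> (x \<in> X \<and> y \<in> X)} \<le> card {x, y}"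
        by (intro card_mono) auto
      also have "\<dots> \<le> 2" by (simp add: card_insert_if)
      finally show ?thesis by blast
    qed
  qed fact
  then show "card {v \<in> L. run (same_cluster [{v}, X - {v}]) T = set [{v}, X - {v}]} \<le> 2 * q + 1"
    by simp
qed

theorem theorem15:
  fixes \<beta> \<gamma> :: real
    and has_radii ::
      "real \<Rightarrow> real \<Rightarrow> (real ^ 2) set \<Rightarrow> (real ^ 2) set list \<Rightarrow> (nat \<Rightarrow> real) \<Rightarrow> bool"
  assumes "0 < \<beta>" and "\<beta> < 1" and "0 < \<gamma>" and "\<gamma> \<le> 1"
    and "has_radii = uniform_radii \<or> has_radii = generalized_radii"
  shows "\<exists>(X :: nat \<Rightarrow> (real ^ 2) set) (D :: nat \<Rightarrow> (real ^ 2) set list pmf) (r :: nat \<Rightarrow> nat \<Rightarrow> real).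
    (\<forall>\<^sub>F n in sequentially. finite (X n) \<and> card (X n) = n \<and>
      (\<forall>C\<in>set_pmf (D n). clustering 2 (X n) C \<and> has_radii \<beta> \<gamma> (X n) C (r n))) \<and>
    (\<forall>p>0. \<forall>(A :: nat \<Rightarrow> (real ^ 2) cluster_algorithm) (q :: nat \<Rightarrow> nat).
      (\<forall>\<^sub>F n in sequentially. query_bound (X n) (D n) (A n) (q n) \<and> recovery_prob (D n) (A n) \<ge> p) \<longrightarrow>
      (\<lambda>n. real (q n)) \<in> \<Omega>(\<lambda>n. real n))"
proof -
  define X where "X n = comb_point ` {..<n}" for n
  \<comment> \<open>These are all leaves of \<open>X n\<close>: \<open>2 * i + 1 < n\<close> holds
    exactly if \<open>i < n div 2\<close>. For odd \<open>n\<close> the last spine point carries no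
    leaf.\<close>
  define L where "L n = (\<lambda>i. comb_point (2 * i + 1)) ` {..<n div 2}" for n
  define D where "D n = map_pmf (\<lambda>v. [{v}, X n - {v}]) (pmf_of_set (L n))" for n
  have card_X: "finite (X n)" "card (X n) = n" for n
    by (simp_all add: X_def card_image inj_on_def)
  have card_L: "finite (L n)" "card (L n) = n div 2" for n
    by (simp_all add: L_def card_image inj_on_def)
  have L: "L n \<subseteq> X n" for n
    by (auto simp: X_def L_def)
  have L_ne: "L n \<noteq> {}" if "3 \<le> n" for n
    using that by (auto simp: L_def lessThan_empty_iff)
  have convex: "clustering 2 (X n) C \<and> has_radii \<beta> \<gamma> (X n) C (\<lambda>_. 1)"
    if n: "4 \<le> n" and C_D: "C \<in> set_pmf (D n)" for n C
  proof -
    have "set_pmf (pmf_of_set (L n)) = L n"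
      using n card_L L_ne by (intro set_pmf_of_set) auto
    then obtain j where j: "2 * j + 1 < n"
      and C: "C = [{comb_point (2 * j + 1)}, X n - {comb_point (2 * j + 1)}]"
      using C_D by (auto simp: D_def L_def)
    \<comment> \<open>The spine points with indices 0 and 2 remain whichever leaf is split off; they
      serve as \<open>a\<close> and \<open>b\<close>.\<close>
    have *: "comb_point (2 * j + 1) \<in> X n"
      "comb_point 0 \<in> X n - {comb_point (2 * j + 1)}" "comb_point 2 \<in> X n - {comb_point (2 * j + 1)}"
      using j n by (auto simp: X_def)
    have "has_radii \<beta> \<gamma> (X n) C (\<lambda>_. 1)"
      unfolding C using assms(5) *
    proof (rule leaf_split_has_radii[where w = "comb_point (2 * j)"])
      show "Digraph_Component.connected (nbr_graph (X n) 1 \<restriction> (X n - {comb_point (2 * j + 1)}))"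
        unfolding X_def using j by (rule comb_connected_without_leaf)
      show "1 \<le> dist x y" if "x \<in> X n" "y \<in> X n" "x \<noteq> y" for x y
        using that comb_point_separated by (auto simp: X_def)
      show "u = comb_point (2 * j)"
        if "u \<in> X n" "u \<noteq> comb_point (2 * j + 1)" "dist u (comb_point (2 * j + 1)) \<le> 1" for u
        using that comb_leaf_neighbour by (auto simp: X_def)
    qed (use assms in auto)
    moreover have "clustering 2 (X n) C"
      unfolding C using * by (intro clustering_split_point) auto
    ultimately show ?thesis by blast
  qed
  have lower: "(\<lambda>n. real (q n)) \<in> \<Omega>(\<lambda>n. real n)"
    if p: "0 < p"
      and ev: "\<forall>\<^sub>F n in sequentially. query_bound (X n) (D n) (A n) (q n) \<and> p \<le> recovery_prob (D n) (A n)"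
    for p A q
  proof (rule landau_omega.bigI)
    \<comment> \<open>The counting bound gives p (n - 1) / 2 \<le> 2 q + 1, that is q \<ge> (p n - p
      - 2) / 4. Once p n \<ge> 2 p + 4, the subtracted p + 2 is at most p n / 2, leaving q \<ge> p n
      / 8.\<close>
    show "0 < p / 8" using p by simp
    have "\<forall>\<^sub>F n in sequentially. max 3 (nat \<lceil>(2 * p + 4) / p\<rceil>) \<le> n"
      by (rule eventually_ge_at_top)
    with ev show "\<forall>\<^sub>F n in sequentially. p / 8 * norm (real n) \<le> norm (real (q n))"
    proof eventually_elim
      case (elim n)
      then have n: "3 \<le> n" "(2 * p + 4) / p \<le> real n" by linarith+
      have "p \<le> real (2 * q n + 1) / real (n div 2)"
        using recovery_prob_split_point_le[of "X n" "L n" "A n" "q n"] elim n card_X card_L L L_ne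
        by (force simp: D_def)
      then have "p * real (n div 2) \<le> 2 * real (q n) + 1"
        using n by (simp add: field_simps)
      moreover have "p * ((real n - 1) / 2) \<le> p * real (n div 2)"
      proof (intro mult_left_mono)
        have "n \<le> 2 * (n div 2) + 1" by presburger
        then have "real n \<le> real (2 * (n div 2) + 1)"
          by (simp only: of_nat_le_iff)
        then show "(real n - 1) / 2 \<le> real (n div 2)" by simp
      qed (use p in simp)
      moreover have "2 * p + 4 \<le> p * real n"
        using n p by (simp add: field_simps)
      ultimately show ?case
        by (simp add: field_simps)
    qed
  qed
  have "\<forall>\<^sub>F n in sequentially. finite (X n) \<and> card (X n) = n \<and>
      (\<forall>C\<in>set_pmf (D n). clustering 2 (X n) C \<and> has_radii \<beta> \<gamma> (X n) C (\<lambda>_. 1))"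
    using eventually_ge_at_top[of 4] by eventually_elim (use card_X convex in blast)
  \<comment> \<open>The radii are constantly 1, independent of the hidden leaf, so knowing them does
    not help the algorithm.\<close>
  with lower show ?thesis
    by (intro exI[of _ X] exI[of _ D] exI[of _ "\<lambda>_ _. 1"]) blast
qed

end
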